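(* Let $\Sigma$ be an alphabet with $|\Sigma|>1$, let $\mathcal{A}=(Q,\sigma,q_0,F)$ be a DFA over $\Sigma$, and let $0<p<1$. Assume that $\mathcal{A}$ is equal-length-distinguishing. Then almost surely the random language $\mathcal{L}(\mathcal{A}^{\leftarrow p})$ is not a recursively enumerable language.
   Context: An alphabet is a nonempty finite set; $\Sigma^*$ is the set of finite words over $\Sigma$ and $|w|$ is the length of a word $w$. A DFA over $\Sigma$ is a tuple $\mathcal{A}=(Q,\sigma,q_0,F)$ with $Q$ a finite set of states, $q_0\in Q$ the initial state, $F\subseteq Q$ the final states and $\sigma:Q\times\Sigma\to Q$ a (total) transition function, extended to words in the usual way; $\mathcal{L}(\mathcal{A})=\{w\in\Sigma^*\mid\sigma(q_0,w)\in F\}$. BSCC: a bottom strongly connected component of the directed graph with vertex set $Q$ and edges $q\to\sigma(q,a)$ for $q\in Q$, $a\in\Sigma$ (a strongly connected component that no edge leaves). Equal-length-distinguishing: $\mathcal{A}$ is equal-length-distinguishing if there exist (possibly identical) BSCCs $\mathcal{C},\mathcal{C}'$ of $\mathcal{A}$, states $q_1\in\mathcal{C}\cap F$ and $q_1'\in\mathcal{C}'\setminus F$, and words $w,w'\in\Sigma^*$ such that $q_1=\sigma(q_0,w)$, $q_1'=\sigma(q_0,w')$ and $|w|=|w'|$. Random language: a random language $R\subseteq\Sigma^*$ is determined by a random process: for each $w\in\Sigma^*$, the membership $w\in R$ is determined independently at random, once and for all, according to some given probability $\mathbf{Pr}(w\in R)\in[0,1]$; i.e. the events $\{w\in R\}$,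 $w\in\Sigma^*$, are mutually independent with the prescribed probabilities. Noisy input: $\mathcal{L}(\mathcal{A}^{\leftarrow p})$ is the random language that changes every letter of a word with probability $p$ uniformly to another letter and then returns the classification of the new word with respect to $\mathcal{L}(\mathcal{A})$; formally, for $w=a_1\ldots a_n\in\Sigma^*$, $$\mathbf{Pr}(w\in\mathcal{L}(\mathcal{A}^{\leftarrow p}))=\sum_{\substack{w'=b_1\ldots b_n\in\mathcal{L}(\mathcal{A})\\ |w'|=|w|}}\ \prod_{1\le i\le n}\Bigl((1-p)\mathbf{1}_{a_i=b_i}+\frac{p}{|\Sigma|-1}\mathbf{1}_{a_i\neq b_i}\Bigr),$$ where $\mathbf{1}_C$ is $1$ if condition $C$ holds and $0$ otherwise. *)

theory Defs
  imports "HOL-Probability.Probability"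
begin

section \<open>Deterministic finite automata\<close>

text \<open>The alphabet and the state set are the universes of the types \<open>'a\<close> and \<open>'q\<close>, which
  are of class \<open>finite\<close> in the theorem; a word is an element of \<open>'a list\<close>.\<close>

record ('a, 'q) dfa =
  delta :: "'q \<Rightarrow> 'a \<Rightarrow> 'q"
  init :: 'q
  final :: "'q set"

definition delta_word :: "('a, 'q) dfa \<Rightarrow> 'q \<Rightarrow> 'a list \<Rightarrow> 'q" where
  "delta_word A q w = foldl (delta A) q w"

definition dfa_lang :: "('a, 'q) dfa \<Rightarrow> 'a list set" where
  "dfa_lang A = {w. delta_word A (init A) w \<in> final A}"

definition dfa_edges :: "('a, 'q) dfa \<Rightarrow> ('q \<times> 'q) set" where
  "dfa_edges A = {(q, delta A q a) | q a. True}"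

definition mutually_reachable :: "('q \<times> 'q) set \<Rightarrow> ('q \<times> 'q) set" where
  "mutually_reachable E = {(u, v). (u, v) \<in> E\<^sup>* \<and> (v, u) \<in> E\<^sup>*}"

definition is_scc :: "('q \<times> 'q) set \<Rightarrow> 'q set \<Rightarrow> bool" where
  "is_scc E C \<longleftrightarrow> C \<in> UNIV // mutually_reachable E"

definition is_bscc :: "('a, 'q) dfa \<Rightarrow> 'q set \<Rightarrow> bool" where
  "is_bscc A C \<longleftrightarrow> is_scc (dfa_edges A) C \<and> (\<forall>(u, v) \<in> dfa_edges A. u \<in> C \<longrightarrow> v \<in> C)"

definition equal_length_distinguishing :: "('a, 'q) dfa \<Rightarrow> bool" where
  "equal_length_distinguishing A \<longleftrightarrow>
     (\<exists>C C' q q' w w'. is_bscc A C \<and> is_bscc A C' \<and>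
        q \<in> C \<inter> final A \<and> q' \<in> C' - final A \<and>
        q = delta_word A (init A) w \<and> q' = delta_word A (init A) w' \<and>
        length w = length w')"

section \<open>Random languages\<close>

text \<open>A random language is a language-valued map on a probability space for which the events
  ``\<open>v\<close> is in the language'' are mutually independent and have the prescribed probabilities.
  (\<open>indep_events\<close> includes the measurability of these events.)\<close>

definition random_language ::
    "'w measure \<Rightarrow> ('w \<Rightarrow> 'a list set) \<Rightarrow> ('a list \<Rightarrow> real) \<Rightarrow> bool" where
  "random_language M R pr \<longleftrightarrow>
     prob_space M \<and>
     prob_space.indep_events M (\<lambda>v. {\<omega> \<in> space M. v \<in> R \<omega>}) UNIV \<and>
     (\<forall>v. measure M {\<omega> \<in> space M. v \<in> R \<omega>} = pr v)"

definition noisy_prob :: "('a::finite, 'q) dfa \<Rightarrow> real \<Rightarrow> 'a list \<Rightarrow> real" where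
  "noisy_prob A p w =
     (\<Sum>w' \<in> {w' \<in> dfa_lang A. length w' = length w}.
        \<Prod>i<length w. (1 - p) * of_bool (w ! i = w' ! i)
                     + p / (real CARD('a) - 1) * of_bool (w ! i \<noteq> w' ! i))"

section \<open>Recursively enumerable languages\<close>

text \<open>A language is recursively enumerable if it is accepted by a deterministic one-tape Turing
  machine with a two-way infinite tape. States and auxiliary tape symbols are taken from the
  natural numbers; every finite set can be renamed into them. A word is accepted if the run on it
  reaches an accepting state; a run stops where no transition is defined.\<close>

datatype 'a tape_symbol = Blank | Letter 'a | Aux nat

datatype direction = MoveLeft | MoveRight

record 'a tm =
  tm_states :: "nat set"
  tm_symbols :: "'a tape_symbol set"
  tm_start :: nat
  tm_accept :: "nat set"
  tm_trans :: "nat \<Rightarrow> 'a tape_symbol \<Rightarrow> (nat \<times> 'a tape_symbol \<times> direction) option"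

definition wf_tm :: "'a tm \<Rightarrow> bool" where
  "wf_tm T \<longleftrightarrow>
     finite (tm_states T) \<and> finite (tm_symbols T) \<and>
     insert Blank (range Letter) \<subseteq> tm_symbols T \<and>
     tm_start T \<in> tm_states T \<and> tm_accept T \<subseteq> tm_states T \<and>
     (\<forall>q x q' y d. tm_trans T q x = Some (q', y, d) \<longrightarrow>
        q \<in> tm_states T \<and> x \<in> tm_symbols T \<and> q' \<in> tm_states T \<and> y \<in> tm_symbols T)"

text \<open>A configuration consists of the state, the tape content and the head position.\<close>

type_synonym 'a tm_config = "nat \<times> (int \<Rightarrow> 'a tape_symbol) \<times> int"

definition tm_init :: "'a tm \<Rightarrow> 'a list \<Rightarrow> 'a tm_config" where
  "tm_init T w =
     (tm_start T, (\<lambda>i. if 0 \<le> i \<and> i < int (length w) then Letter (w ! nat i) else Blank), 0)"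

fun move :: "direction \<Rightarrow> int \<Rightarrow> int" where
  "move MoveLeft h = h - 1"
| "move MoveRight h = h + 1"

inductive tm_step :: "'a tm \<Rightarrow> 'a tm_config \<Rightarrow> 'a tm_config \<Rightarrow> bool" for T where
  "tm_trans T q (t h) = Some (q', y, d) \<Longrightarrow> tm_step T (q, t, h) (q', t(h := y), move d h)"

definition tm_lang :: "'a tm \<Rightarrow> 'a list set" where
  "tm_lang T = {w. \<exists>q t h. (tm_step T)\<^sup>*\<^sup>* (tm_init T w) (q, t, h) \<and> q \<in> tm_accept T}"

definition recursively_enumerable :: "'a list set \<Rightarrow> bool" where
  "recursively_enumerable L \<longleftrightarrow> (\<exists>T. wf_tm T \<and> tm_lang T = L)"

end

theory Submission
  imports Defs
begin

text \<open>There are only countably many recursively enumerable languages, so it suffices that the random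
  language differs almost surely from each fixed language. By independence this follows once
  infinitely many words have acceptance probability in \<open>[c, 1 - c]\<close> for a single \<open>c > 0\<close>.

  Such words are found as follows. Let \<open>q\<close> and \<open>q'\<close> be the final and the nonfinal bottom state, both
  reached in \<open>n\<^sub>0\<close> steps, and let \<open>L\<close> be a common length of loops at \<open>q\<close> and at \<open>q'\<close>. From every
  state that is reached from \<open>q\<close> in a multiple of \<open>L\<close> steps one can return to \<open>q\<close> in exactly \<open>K\<close>
  steps, with \<open>K\<close> independent of that state, and likewise for \<open>q'\<close>. Whatever the input letter is,
  each letter is read with probability at least some \<open>\<eta> > 0\<close>. Hence on every input of length
  \<open>n\<^sub>0 + j L + K\<close> the noisy run ends in \<open>q\<close> with probability at least \<open>\<eta> ^ (n\<^sub>0 + K)\<close>, by prescribing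
  only the first \<open>n\<^sub>0\<close> and the last \<open>K\<close> letters, and the same holds for \<open>q'\<close>.\<close>

section \<open>Countability of the recursively enumerable languages\<close>

lemma countable_tape_symbols: "countable (UNIV :: 'a::finite tape_symbol set)"
proof -
  have "x \<in> insert Blank (range Letter \<union> range Aux)" for x :: "'a tape_symbol"
    by (cases x) auto
  then have "(UNIV :: 'a tape_symbol set) = insert Blank (range Letter \<union> range Aux)"
    by blast
  then show ?thesis
    by (metis countable_Un countable_finite countable_image countable_insert finite finite_imageI
        countableI_type)
qed

text \<open>Well-formedness makes the graph of the transition function finite, so a machine is coded
  injectively by finite subsets of countable sets and a start state.\<close>

lemma countable_wf_tm: "countable {T :: 'a::finite tm. wf_tm T}"
proof -
  define graph :: "'a tm \<Rightarrow> (nat \<times> 'a tape_symbol \<times> nat \<times> 'a tape_symbol \<times> direction) set"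
    where "graph T = {(q, x, r). tm_trans T q x = Some r}" for T
  define code where "code T = (tm_states T, tm_symbols T, tm_start T, tm_accept T, graph T)"
    for T :: "'a tm"
  have dir: "(UNIV :: direction set) = {MoveLeft, MoveRight}"
    by (auto intro: direction.exhaust)
  have fin_graph: "finite (graph T)" if "wf_tm T" for T
  proof (rule finite_subset)
    show "graph T \<subseteq> tm_states T \<times> tm_symbols T \<times> tm_states T \<times> tm_symbols T \<times> UNIV"
      using that unfolding graph_def wf_tm_def by fast
    show "finite (tm_states T \<times> tm_symbols T \<times> tm_states T \<times> tm_symbols T \<times> (UNIV :: direction set))"
      using that by (simp add: wf_tm_def dir)
  qed
  have "code ` {T. wf_tm T} \<subseteq> {S. finite S \<and> S \<subseteq> UNIV} \<times> {S. finite S \<and> S \<subseteq> UNIV} \<times> UNIV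
      \<times> {S. finite S \<and> S \<subseteq> UNIV}
      \<times> {S. finite S \<and> S \<subseteq> UNIV \<times> UNIV \<times> UNIV \<times> UNIV \<times> UNIV}"
    by (auto simp: code_def fin_graph) (auto simp: wf_tm_def intro: finite_subset)
  moreover have "countable ({S. finite S \<and> S \<subseteq> UNIV} \<times> {S. finite S \<and> S \<subseteq> UNIV} \<times> UNIV
      \<times> {S. finite S \<and> S \<subseteq> UNIV}
      \<times> {S. finite S \<and> S \<subseteq> UNIV \<times> UNIV \<times> UNIV \<times> UNIV \<times> UNIV} ::
        (nat set \<times> 'a tape_symbol set \<times> nat \<times> nat set \<times>
         (nat \<times> 'a tape_symbol \<times> nat \<times> 'a tape_symbol \<times> direction) set) set)"
    by (intro countable_SIGMA countable_Collect_finite_subset countable_tape_symbols)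
      (auto simp: dir)
  ultimately have "countable (code ` {T. wf_tm T})"
    by (rule countable_subset)
  moreover have "inj_on code {T. wf_tm T}"
  proof (rule inj_onI)
    fix T U assume eq: "code T = code U"
    have "tm_trans T q x = tm_trans U q x" for q x
    proof -
      have "tm_trans T q x = Some r \<longleftrightarrow> tm_trans U q x = Some r" for r
      proof -
        have "(q, x, r) \<in> graph T \<longleftrightarrow> (q, x, r) \<in> graph U"
          using eq by (simp add: code_def)
        then show ?thesis
          by (simp add: graph_def)
      qed
      then show ?thesis
        by (metis option.exhaust)
    qed
    then show "T = U"
      using eq by (intro tm.equality) (auto simp: code_def)
  qed
  ultimately show ?thesis
    by (rule countable_image_inj_on)
qed

lemma countable_recursively_enumerable:
  "countable {L :: 'a::finite list set. recursively_enumerable L}"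
proof -
  have "{L :: 'a list set. recursively_enumerable L} = tm_lang ` {T. wf_tm T}"
    by (auto simp: recursively_enumerable_def)
  then show ?thesis
    by (simp add: countable_wf_tm)
qed

section \<open>Returning to a bottom state\<close>

lemma delta_word_append: "delta_word A q (u @ v) = delta_word A (delta_word A q u) v"
  by (simp add: delta_word_def)

lemma delta_word_loop:
  "delta_word A q u = q \<Longrightarrow> delta_word A q (concat (replicate n u)) = q"
  by (induction n) (auto simp: delta_word_append, simp add: delta_word_def)

lemma delta_word_reachable: "(q, delta_word A q u) \<in> (dfa_edges A)\<^sup>*"
proof (induction u rule: rev_induct)
  case (snoc a u)
  have "(delta_word A q u, delta_word A q (u @ [a])) \<in> dfa_edges A"
    by (auto simp: dfa_edges_def delta_word_def)
  with snoc show ?case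
    by (rule rtrancl_into_rtrancl)
qed (simp add: delta_word_def)

lemma reachable_delta_word:
  assumes "(q, s) \<in> (dfa_edges A)\<^sup>*"
  obtains u where "delta_word A q u = s"
proof -
  from assms have "\<exists>u. delta_word A q u = s"
  proof induction
    case base
    have "delta_word A q [] = q"
      by (simp add: delta_word_def)
    then show ?case ..
  next
    case (step s t)
    then obtain u a where "delta_word A q u = s" "t = delta A s a"
      by (auto simp: dfa_edges_def)
    then have "delta_word A q (u @ [a]) = t"
      by (simp add: delta_word_def)
    then show ?case ..
  qed
  with that show ?thesis by blast
qed

text \<open>No edge leaves \<open>C\<close>, so every run from \<open>q\<close> stays in
  \<open>C\<close>, and strong connectivity gives a path back, which some word spells.\<close>

lemma bscc_return:
  assumes "is_bscc A C" "q \<in> C"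
  shows "\<exists>v. delta_word A (delta_word A q u) v = q"
proof -
  let ?E = "dfa_edges A"
  have "s \<in> C" if "(q, s) \<in> ?E\<^sup>*" for s
    using that assms by induction (auto simp: is_bscc_def)
  then have "delta_word A q u \<in> C"
    using delta_word_reachable by fast
  moreover obtain r where "C = mutually_reachable ?E `` {r}"
    using assms(1) by (auto simp: is_bscc_def is_scc_def elim: quotientE)
  ultimately have "(delta_word A q u, q) \<in> ?E\<^sup>*"
    using assms(2) by (auto simp: mutually_reachable_def)
  then show ?thesis
    by (meson reachable_delta_word)
qed

text \<open>Return words whose lengths are multiples of \<open>length l\<close> can be padded with
  copies of \<open>l\<close> once they are back at \<open>q\<close>. There are finitely many states,
  so one threshold serves them all.\<close>

lemma uniform_return:
  fixes A :: "('a, 'q::finite) dfa"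
  assumes return: "\<And>u. \<exists>v. delta_word A (delta_word A q u) v = q"
    and loop: "delta_word A q l = q" and "l \<noteq> []"
  shows "\<exists>N. \<forall>n\<ge>N. \<forall>u :: 'a list. length l dvd length u \<longrightarrow>
           (\<exists>y. length y = n * length l \<and> delta_word A (delta_word A q u) y = q)"
proof -
  let ?L = "length l"
  define ret where "ret m s \<longleftrightarrow> (\<exists>y. length y = m * ?L \<and> delta_word A s y = q)" for m s
  have ex: "\<exists>m. ret m (delta_word A q u)" if u: "?L dvd length u" for u
  proof -
    obtain v where v: "delta_word A (delta_word A q u) v = q"
      using return by blast
    \<comment> \<open>\<open>y\<close> contains \<open>v\<close> exactly \<open>length l\<close> times, which makes its length a multiple of \<open>length l\<close>.\<close>
    define y where "y = v @ concat (replicate (?L - 1) (u @ v))"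
    have "length y = ?L * length v + (?L - 1) * length u"
      using \<open>l \<noteq> []\<close>
      by (cases l) (auto simp: y_def length_concat sum_list_replicate algebra_simps)
    with u have "?L dvd length y"
      by simp
    then obtain m where "length y = m * ?L"
      by (metis dvdE mult.commute)
    moreover have "delta_word A (delta_word A q u) y = q"
      using v by (simp add: y_def delta_word_append delta_word_loop)
    ultimately show ?thesis
      by (auto simp: ret_def)
  qed
  \<comment> \<open>For a state without such a return word the value is arbitrary; it can only
    enlarge the maximum.\<close>
  define g where "g s = (SOME m. ret m s)" for s
  show ?thesis
  proof (intro exI[of _ "Max (range g)"] allI impI)
    fix n and u :: "'a list" assume n: "Max (range g) \<le> n" and u: "?L dvd length u"
    let ?s = "delta_word A q u"
    have "ret (g ?s) ?s"
      unfolding g_def using ex[OF u] by (rule someI_ex)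
    then obtain y where y: "length y = g ?s * ?L" "delta_word A ?s y = q"
      by (auto simp: ret_def)
    have "g ?s \<le> n"
      using n by (simp add: Max_le_iff)
    then have "length (y @ concat (replicate (n - g ?s) l)) = n * ?L"
      by (simp add: y length_concat sum_list_replicate flip: add_mult_distrib)
    moreover have "delta_word A ?s (y @ concat (replicate (n - g ?s) l)) = q"
      by (simp add: delta_word_append y delta_word_loop loop)
    ultimately show "\<exists>y. length y = n * ?L \<and> delta_word A ?s y = q"
      by blast
  qed
qed

section \<open>Acceptance probabilities under noise\<close>

definition noise :: "real \<Rightarrow> 'a::finite \<Rightarrow> 'a \<Rightarrow> real" where
  "noise p a b = (1 - p) * of_bool (a = b) + p / (real CARD('a) - 1) * of_bool (a \<noteq> b)"

text \<open>For words of equal length this is the probability that the noise turns \<open>v\<close>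
  into \<open>w\<close>.\<close>

definition noise_word :: "real \<Rightarrow> 'a::finite list \<Rightarrow> 'a list \<Rightarrow> real" where
  "noise_word p v w = (\<Prod>i<length v. noise p (v ! i) (w ! i))"

lemma noisy_prob_eq_sum:
  "noisy_prob A p v = (\<Sum>w \<in> {w \<in> dfa_lang A. length w = length v}. noise_word p v w)"
  by (simp add: noisy_prob_def noise_word_def noise_def)

lemma noise_word_simps [simp]:
  "noise_word p [] w = 1"
  "noise_word p (a # v) (b # w) = noise p a b * noise_word p v w"
  by (simp_all add: noise_word_def prod.lessThan_Suc_shift del: prod.lessThan_Suc)

lemma noise_word_append:
  "length v = length w \<Longrightarrow>
    noise_word p (v @ v') (w @ w') = noise_word p v w * noise_word p v' w'"
  by (induction v w rule: list_induct2) auto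

lemma finite_words_length: "finite {w :: 'a::finite list. P w \<and> length w = n}"
  using finite_lists_length_eq[of "UNIV :: 'a set" n] by (rule rev_finite_subset) auto

lemma sum_noise:
  fixes a :: "'a::finite"
  assumes "CARD('a) > 1"
  shows "(\<Sum>b\<in>UNIV. noise p a b) = 1"
proof -
  have "(\<Sum>b\<in>UNIV. noise p a b) = noise p a a + (\<Sum>b\<in>UNIV - {a}. noise p a b)"
    by (simp add: sum.remove)
  also have "(\<Sum>b\<in>UNIV - {a}. noise p a b) = (\<Sum>b\<in>UNIV - {a}. p / (real CARD('a) - 1))"
    by (intro sum.cong) (auto simp: noise_def)
  also have "noise p a a + \<dots> = 1"
    using assms by (simp add: noise_def card_Diff_singleton of_nat_diff)
  finally show ?thesis .
qed

text \<open>Letters are changed independently, so the sum factors into the mass of the first letter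
  and that of the rest.\<close>

lemma sum_noise_word:
  fixes v :: "'a::finite list"
  assumes "CARD('a) > 1"
  shows "(\<Sum>w | length w = length v. noise_word p v w) = 1"
proof (induction v)
  case (Cons a v)
  have "{w :: 'a list. length w = Suc (length v)}
      = (\<lambda>(b, w). b # w) ` (UNIV \<times> {w. length w = length v})"
    by (auto simp: length_Suc_conv image_iff)
  then have "(\<Sum>w | length w = length (a # v). noise_word p (a # v) w)
      = (\<Sum>(b, w) \<in> UNIV \<times> {w. length w = length v}. noise p a b * noise_word p v w)"
    by (simp add: sum.reindex inj_on_def case_prod_unfold)
  also have "\<dots> = (\<Sum>b\<in>UNIV. noise p a b) * (\<Sum>w | length w = length v. noise_word p v w)"
    by (simp add: sum_product sum.cartesian_product)
  finally show ?case
    using Cons sum_noise[OF assms] by simp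
qed simp

lemma noise_word_lower:
  fixes v w :: "'a::finite list"
  assumes "\<And>a b :: 'a. \<eta> \<le> noise p a b" "0 \<le> \<eta>" "length v = length w"
  shows "\<eta> ^ length v \<le> noise_word p v w"
  using assms(3)
proof (induction v w rule: list_induct2)
  case (Cons a v b w)
  then show ?case
    using assms(1)[of a b] assms(2) by (auto intro!: mult_mono)
qed simp

text \<open>Only the prefix and the suffix are prescribed, each letter costing a factor \<eta>. The
  middle is free and contributes total mass 1, so the bound does not depend on its length.\<close>

lemma sum_noise_word_lower:
  fixes pre mid post :: "'a::finite list"
  assumes card: "CARD('a) > 1"
    and \<eta>: "\<And>a b :: 'a. \<eta> \<le> noise p a b" "0 \<le> \<eta>"
    and w: "length w = length pre"
    and ex: "\<And>x. length x = length mid \<Longrightarrow> \<exists>y. length y = length post \<and> P (w @ x @ y)"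
  shows "\<eta> ^ (length pre + length post)
      \<le> (\<Sum>u | P u \<and> length u = length (pre @ mid @ post). noise_word p (pre @ mid @ post) u)"
proof -
  let ?v = "pre @ mid @ post" and ?X = "{x :: 'a list. length x = length mid}"
  have nonneg: "0 \<le> noise_word p v u" for v u :: "'a list"
    unfolding noise_word_def by (intro prod_nonneg) (auto intro: order_trans[OF \<eta>(2,1)])
  \<comment> \<open>The suffix must depend on the middle block, since it steers the run from
    wherever that block led.\<close>
  obtain y where y: "\<And>x. length x = length mid \<Longrightarrow> length (y x) = length post \<and> P (w @ x @ y x)"
    using ex by metis
  define f where "f x = w @ x @ y x" for x
  have "\<eta> ^ (length pre + length post)
      = \<eta> ^ length pre * (\<Sum>x\<in>?X. noise_word p mid x) * \<eta> ^ length post"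
    by (simp add: sum_noise_word[OF card] power_add)
  also have "\<dots> = (\<Sum>x\<in>?X. \<eta> ^ length pre * (noise_word p mid x * \<eta> ^ length post))"
    by (simp add: sum_distrib_left sum_distrib_right mult.assoc)
  also have "\<dots> \<le> (\<Sum>x\<in>?X. noise_word p pre w * (noise_word p mid x * noise_word p post (y x)))"
    using \<eta> w y
    by (intro sum_mono mult_mono noise_word_lower) (auto intro!: mult_nonneg_nonneg nonneg)
  also have "\<dots> = (\<Sum>x\<in>?X. noise_word p ?v (f x))"
    using w by (intro sum.cong) (auto simp: f_def noise_word_append)
  \<comment> \<open>\<open>f\<close> is injective on \<open>?X\<close>: the block after
    \<open>w\<close> of length \<open>length mid\<close> is \<open>x\<close> itself.\<close>
  also have "\<dots> = (\<Sum>u \<in> f ` ?X. noise_word p ?v u)"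
    by (subst sum.reindex) (auto simp: inj_on_def f_def)
  also have "\<dots> \<le> (\<Sum>u | P u \<and> length u = length ?v. noise_word p ?v u)"
    using w y by (intro sum_mono2 finite_words_length) (auto simp: f_def nonneg)
  finally show ?thesis .
qed

lemma noise_lower_bound:
  assumes "CARD('a::finite) > 1" "0 < p" "p < 1"
  shows "\<exists>\<eta>>0. \<forall>a b :: 'a. \<eta> \<le> noise p a b"
  using assms by (intro exI[of _ "min (1 - p) (p / (real CARD('a) - 1))"]) (auto simp: noise_def)

text \<open>On the same input words, the accepted and the rejected mass are each at least
  \<open>c\<close>, and they add up to 1.\<close>

lemma noisy_prob_bounded_away:
  fixes A :: "('a::finite, 'q::finite) dfa"
  assumes card: "CARD('a) > 1" and p: "0 < p" "p < 1" and "equal_length_distinguishing A"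
  obtains c where "c > 0" "infinite {v. c \<le> noisy_prob A p v \<and> noisy_prob A p v \<le> 1 - c}"
proof -
  obtain C C' q q' w w' where
    C: "is_bscc A C" "is_bscc A C'" "q \<in> C" "q \<in> final A" "q' \<in> C'" "q' \<notin> final A"
    and w: "delta_word A (init A) w = q" "delta_word A (init A) w' = q'" "length w' = length w"
    using assms(4) unfolding equal_length_distinguishing_def by (metis DiffE IntE)
  note return = bscc_return[OF C(1,3)] bscc_return[OF C(2,5)]
  have nontrivial_loop: "\<exists>l. l \<noteq> [] \<and> delta_word A s l = s"
    if ret: "\<And>u :: 'a list. \<exists>v. delta_word A (delta_word A s u) v = s" for s
  proof -
    \<comment> \<open>Reading an arbitrary first letter forces the loop to be nonempty.\<close>
    obtain v where "delta_word A (delta_word A s [undefined]) v = s"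
      using ret by blast
    then have "delta_word A s ([undefined] @ v) = s"
      by (simp only: delta_word_append)
    then show ?thesis
      by blast
  qed
  obtain l l' where l: "l \<noteq> []" "l' \<noteq> []" "delta_word A q l = q" "delta_word A q' l' = q'"
    using nontrivial_loop[OF return(1)] nontrivial_loop[OF return(2)] by blast
  \<comment> \<open>Repeating each loop as often as the other one is long gives both the length
    \<open>L\<close>.\<close>
  define k where "k = concat (replicate (length l') l)"
  define k' where "k' = concat (replicate (length l) l')"
  define L where "L = length l * length l'"
  have L: "length k = L" "length k' = L" "L > 0"
    using l by (auto simp: k_def k'_def L_def length_concat sum_list_replicate)
  then have "k \<noteq> []" "k' \<noteq> []"
    by auto
  have k: "delta_word A q k = q" "delta_word A q' k' = q'"
    using l by (simp_all add: k_def k'_def delta_word_loop)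
  obtain N1 where N1: "\<And>n u. n \<ge> N1 \<Longrightarrow> L dvd length u \<Longrightarrow>
      \<exists>y. length y = n * L \<and> delta_word A (delta_word A q u) y = q"
    using uniform_return[OF return(1) k(1) \<open>k \<noteq> []\<close>] unfolding L by blast
  obtain N2 where N2: "\<And>n u. n \<ge> N2 \<Longrightarrow> L dvd length u \<Longrightarrow>
      \<exists>y. length y = n * L \<and> delta_word A (delta_word A q' u) y = q'"
    using uniform_return[OF return(2) k(2) \<open>k' \<noteq> []\<close>] unfolding L by blast
  \<comment> \<open>The larger threshold gives one suffix length that works for both
    \<open>q\<close> and \<open>q'\<close>.\<close>
  define K where "K = max N1 N2 * L"
  obtain \<eta> where \<eta>: "\<eta> > 0" "\<And>a b :: 'a. \<eta> \<le> noise p a b"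
    using noise_lower_bound[OF card p] by blast
  define c where "c = \<eta> ^ (length w + K)"
  \<comment> \<open>Only the block lengths matter, because \<eta> bounds the noise for every input
    letter.\<close>
  define word :: "nat \<Rightarrow> 'a list" where
    "word j = replicate (length w) undefined @ replicate (j * L) undefined @ replicate K undefined"
    for j
  have lower: "c \<le> (\<Sum>u | u \<in> dfa_lang A \<and> length u = length (word j). noise_word p (word j) u)"
    for j
  proof -
    have "\<exists>y. length y = K \<and> w @ x @ y \<in> dfa_lang A" if "length x = j * L" for x
      using N1[of "max N1 N2" x] that C w by (auto simp: K_def dfa_lang_def delta_word_append)
    then show ?thesis
      using sum_noise_word_lower[OF card \<eta>(2), where w = w
          and pre = "replicate (length w) undefined" and mid = "replicate (j * L) undefined"
          and post = "replicate K undefined" and P = "\<lambda>u. u \<in> dfa_lang A"] \<eta>(1)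
      by (simp add: word_def c_def)
  qed
  have upper: "c \<le> (\<Sum>u | u \<notin> dfa_lang A \<and> length u = length (word j). noise_word p (word j) u)"
    for j
  proof -
    have "\<exists>y. length y = K \<and> w' @ x @ y \<notin> dfa_lang A" if "length x = j * L" for x
      using N2[of "max N1 N2" x] that C w by (auto simp: K_def dfa_lang_def delta_word_append)
    then show ?thesis
      using sum_noise_word_lower[OF card \<eta>(2), where w = w'
          and pre = "replicate (length w) undefined" and mid = "replicate (j * L) undefined"
          and post = "replicate K undefined" and P = "\<lambda>u. u \<notin> dfa_lang A"] \<eta>(1) w(3)
      by (simp add: word_def c_def)
  qed
  have split: "noisy_prob A p v
      + (\<Sum>u | u \<notin> dfa_lang A \<and> length u = length v. noise_word p v u) = 1" for v
  proof -
    have "noisy_prob A p v + (\<Sum>u | u \<notin> dfa_lang A \<and> length u = length v. noise_word p v u)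
        = (\<Sum>u \<in> {u \<in> dfa_lang A. length u = length v}
            \<union> {u. u \<notin> dfa_lang A \<and> length u = length v}. noise_word p v u)"
      unfolding noisy_prob_eq_sum
      by (rule sum.union_disjoint[symmetric]) (auto simp only: finite_words_length)
    also have "\<dots> = (\<Sum>u | length u = length v. noise_word p v u)"
      by (rule sum.cong) auto
    finally show ?thesis
      by (simp only: sum_noise_word[OF card])
  qed
  have "range word \<subseteq> {v. c \<le> noisy_prob A p v \<and> noisy_prob A p v \<le> 1 - c}"
  proof safe
    fix j
    show "c \<le> noisy_prob A p (word j)"
      using lower[of j] by (simp add: noisy_prob_eq_sum)
    show "noisy_prob A p (word j) \<le> 1 - c"
      using upper[of j] split[of "word j"] by simp
  qed
  moreover have "inj word"
  proof (rule injI)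
    fix i j assume "word i = word j"
    then have "length (word i) = length (word j)"
      by simp
    then show "i = j"
      using L(3) by (simp add: word_def)
  qed
  then have "infinite (range word)"
    by (simp add: finite_image_iff)
  ultimately have "infinite {v. c \<le> noisy_prob A p v \<and> noisy_prob A p v \<le> 1 - c}"
    by (rule infinite_super)
  moreover have "c > 0"
    using \<eta> by (simp add: c_def)
  ultimately show ?thesis
    using that by blast
qed

section \<open>Random languages avoid fixed languages\<close>

text \<open>Independence passes from the single events to the sigma-algebras they generate, and
  these contain the complements.\<close>

lemma (in prob_space) indep_events_compl:
  assumes "indep_events E I"
  shows "indep_events (\<lambda>i. if i \<in> J then E i else space M - E i) I"
proof -
  have "indep_sets (\<lambda>i. {E i}) I"
    using assms by (simp add: indep_events_def_alt)
  then have indep: "indep_sets (\<lambda>i. sigma_sets (space M) {E i}) I"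
    by (rule indep_sets_sigma) (auto simp: Int_stable_def)
  have "(if i \<in> J then E i else space M - E i) \<in> sigma_sets (space M) {E i}" for i
    by (auto intro: sigma_sets.intros)
  then show ?thesis
    unfolding indep_events_def_alt by (intro indep_sets_mono_sets[OF indep]) auto
qed

text \<open>Equality with \<open>L\<close> forces agreement on infinitely many words. These
  agreements are independent and each has probability at most \<open>1 - c\<close>, so
  \<open>n\<close> of them together have probability at most \<open>(1 - c) ^ n\<close>.\<close>

lemma random_language_AE_neq:
  fixes R :: "'w \<Rightarrow> 'a list set"
  assumes R: "random_language M R pr" and "c > 0" and inf: "infinite {v. c \<le> pr v \<and> pr v \<le> 1 - c}"
  shows "AE \<omega> in M. R \<omega> \<noteq> L"
proof -
  interpret prob_space M
    using R by (simp add: random_language_def)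
  define W where "W = {v. c \<le> pr v \<and> pr v \<le> 1 - c}"
  define E where "E v = {\<omega> \<in> space M. v \<in> R \<omega>}" for v
  \<comment> \<open>\<open>G v\<close> is the event that \<open>R\<close> and \<open>L\<close> agree
    on \<open>v\<close>.\<close>
  define G where "G v = (if v \<in> L then E v else space M - E v)" for v
  have E: "indep_events E UNIV" "\<And>v. prob (E v) = pr v"
    using R by (auto simp: random_language_def E_def[abs_def])
  have G: "indep_events G UNIV"
    unfolding G_def by (rule indep_events_compl[OF E(1)])
  have ev: "E v \<in> events" "G v \<in> events" for v
    using E(1) G by (auto simp: indep_events_def)
  have G_le: "prob (G v) \<le> 1 - c" if "v \<in> W" for v
    using that ev E(2) by (auto simp: G_def W_def prob_compl)
  \<comment> \<open>A sequence in \<open>W\<close> keeps the intersection below countable, hence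
    measurable.\<close>
  obtain s :: "nat \<Rightarrow> 'a list" where s: "inj s" "range s \<subseteq> W"
    using inf unfolding W_def by (meson infinite_countable_subset)
  have bound: "prob (\<Inter>v\<in>range s. G v) \<le> (1 - c) ^ n" for n
  proof (cases n)
    case 0
    then show ?thesis
      by simp
  next
    case (Suc m)
    \<comment> \<open>\<open>indep_events\<close> gives the product formula for nonempty finite
      index sets only, so \<open>n = 0\<close> is treated apart.\<close>
    then have ne: "s ` {..<n} \<noteq> {}"
      by auto
    have "prob (\<Inter>v\<in>range s. G v) \<le> prob (\<Inter>v\<in>s ` {..<n}. G v)"
      using ne ev by (intro finite_measure_mono sets.finite_INT) auto
    also have "\<dots> = (\<Prod>v\<in>s ` {..<n}. prob (G v))"
      using G ne unfolding indep_events_def by (metis finite_imageI finite_lessThan subset_UNIV)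
    also have "\<dots> = (\<Prod>i<n. prob (G (s i)))"
      using s(1) by (subst prod.reindex) (auto intro: inj_on_subset)
    also have "\<dots> \<le> (\<Prod>i<n. 1 - c)"
      using s(2) by (intro prod_mono) (auto intro!: G_le)
    finally show ?thesis
      by simp
  qed
  \<comment> \<open>A member of \<open>W\<close> shows that \<open>c\<close> is at most 1, so the
    powers of \<open>1 - c\<close> converge to 0.\<close>
  obtain v where "v \<in> W"
    using s by auto
  then have "0 \<le> 1 - c"
    using G_le[of v] measure_nonneg[of M "G v"] by linarith
  then have "(\<lambda>n. (1 - c) ^ n) \<longlonglongrightarrow> 0"
    using \<open>c > 0\<close> by (intro LIMSEQ_power_zero) auto
  then have "prob (\<Inter>v\<in>range s. G v) \<le> 0"
    using bound by (intro LIMSEQ_le_const) auto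
  moreover have "(\<Inter>v\<in>range s. G v) \<in> events"
    using ev by (intro sets.countable_INT') auto
  ultimately have "(\<Inter>v\<in>range s. G v) \<in> null_sets M"
    by (auto simp: null_sets_def emeasure_eq_measure measure_le_0_iff)
  then show ?thesis
    by (rule AE_I') (auto simp: G_def E_def)
qed

theorem theorem4p6:
  fixes A :: "('a::finite, 'q::finite) dfa"
    and p :: real
    and M :: "'w measure"
    and R :: "'w \<Rightarrow> 'a list set"
  assumes "CARD('a) > 1"
    and "0 < p" and "p < 1"
    and "equal_length_distinguishing A"
    and "random_language M R (noisy_prob A p)"
  shows "AE \<omega> in M. \<not> recursively_enumerable (R \<omega>)"
proof -
  obtain c where "c > 0" "infinite {v. c \<le> noisy_prob A p v \<and> noisy_prob A p v \<le> 1 - c}"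
    using noisy_prob_bounded_away assms(1-4) by blast
  then have "AE \<omega> in M. R \<omega> \<noteq> L" for L
    by (rule random_language_AE_neq[OF assms(5)])
  \<comment> \<open>The exceptional null set may depend on \<open>L\<close>; countability allows the
    quantifier to move inside.\<close>
  then have "AE \<omega> in M. \<forall>L \<in> {L. recursively_enumerable L}. R \<omega> \<noteq> L"
    by (subst AE_ball_countable[OF countable_recursively_enumerable]) blast
  then show ?thesis
    by (rule AE_mp) auto
qed

end
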